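(* Let $n\ge 1$, let $\mathcal{X}=\mathcal{X}_1\times\cdots\times\mathcal{X}_n$ be a product of nonempty finite sets, let $\mathbf{p}\in\mathcal{P}$ have entropy vector $\mathbf{h}=\mathbf{h}(\mathbf{p})\neq\mathbf{0}$, and let $\mathbf{h}_t\in\Gamma_n\setminus\{\mathbf{0}\}$. Suppose there is no perturbation $\mathbf{h}'$ of $\mathbf{h}$ (i.e. no $\mathbf{h}'\in\Gamma^*_{n,\mathcal{X}}\setminus\{\mathbf{0}\}$) such that $d_{\mathrm{norm}}(\mathbf{h}',\mathbf{h}_t)<d_{\mathrm{norm}}(\mathbf{h},\mathbf{h}_t)$. Then either $\mathbf{h}\in E_{\mathbf{h}_t}$ or $\mathbf{h}$ lies on the (topological) boundary of $\Gamma^*_{n,\mathcal{X}}$ in $\mathbb{R}^{2^n-1}$.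
   Context: Let $\mathcal{N}=\{1,\dots,n\}$. $\mathcal{P}$ is the set of all probability mass functions $\mathbf{p}=[p(\mathbf{x}),\mathbf{x}\in\mathcal{X}]$ on $\mathcal{X}$, viewed as a subset of $\mathbb{R}^{|\mathcal{X}|}$. For $\mathbf{p}\in\mathcal{P}$ and nonempty $\alpha\subseteq\mathcal{N}$, $\mathbf{p}(X_\alpha)$ is the marginal pmf on $\prod_{i\in\alpha}\mathcal{X}_i$. The entropy vector of $\mathbf{p}$ is $\mathbf{h}(\mathbf{p})=[h(\mathbf{p}(X_\alpha)),\ \emptyset\ne\alpha\subseteq\mathcal{N}]\in\mathbb{R}^{2^n-1}$, where $h$ is Shannon entropy (logarithm to a fixed base greater than $1$, $0\log 0=0$). The alphabet constrained entropic set is $\Gamma^*_{n,\mathcal{X}}=\{\mathbf{h}(\mathbf{p}):\mathbf{p}\in\mathcal{P}\}$. Any change in a quantity is called a perturbation; a perturbation of an entropic vector $\mathbf{h}$ is another vector $\mathbf{h}'\in\Gamma^*_{n,\mathcal{X}}$. $\Gamma_n\subset\mathbb{R}^{2^n-1}$ is the set of polymatroids: vectors $[h_\alpha,\emptyset\neq\alpha\subseteq\mathcal{N}]$ which, with $h_\emptyset=0$, satisfy $h_\alpha\ge 0$, $h_\alpha\le h_\beta$ for $\alpha\subseteq\beta$, and $h_\alpha+h_\beta\ge h_{\alpha\cup\beta}+h_{\alpha\cap\beta}$. One has $\Gamma^*_{n,\mathcal{X}}\subseteq\Gamma_n$. For $\mathbf{y}\ne\mathbf{0}$ put $E_{\mathbf{y}}=\{a\mathbf{y}:a>0\}$.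 For $\mathbf{x},\mathbf{y}\in\Gamma_n\setminus\{\mathbf{0}\}$ the normalized distance is $d_{\mathrm{norm}}(\mathbf{x},\mathbf{y})=\|\mathbf{x}-\mathbf{y}'\|/\|\mathbf{y}'\|$, where $\mathbf{y}'$ is the point of $E_{\mathbf{y}}$ closest to $\mathbf{x}$ in Euclidean norm (it exists, is unique and nonzero since $\mathbf{x}\cdot\mathbf{y}>0$ for nonzero polymatroids). Equivalently $d_{\mathrm{norm}}(\mathbf{x},\mathbf{y})=\tan\theta$ with $\theta$ the angle between $\mathbf{x}$ and $\mathbf{y}$. *)

theory Defs
  imports "HOL-Probability.Probability"
begin

text \<open>
  The index set \<open>{1..n}\<close> is the universe of a finite type \<open>'n\<close>, with \<open>n = CARD('n) \<ge> 1\<close>.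
  The type of nonempty subsets has \<open>2^n - 1\<close> elements, so that the space of entropy vectors is
  \<open>real ^ 'n nonempty_subset\<close>. Including a coordinate for the empty set instead would change
  the topology: the entropic region would then have empty interior.
\<close>

typedef 'n nonempty_subset = "{\<alpha> :: 'n set. \<alpha> \<noteq> {}}"
  morphisms the_subset Nonempty
  by auto

instance nonempty_subset :: (finite) finite
proof
  have "range (the_subset :: 'a nonempty_subset \<Rightarrow> 'a set) \<subseteq> UNIV"
    by simp
  moreover have "inj (the_subset :: 'a nonempty_subset \<Rightarrow> 'a set)"
    by (simp add: inj_def the_subset_inject)
  ultimately show "finite (UNIV :: 'a nonempty_subset set)"
    using finite_imageD finite by blast
qed

lemma card_nonempty_subset: "CARD('n::finite nonempty_subset) = 2 ^ CARD('n) - 1"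
proof -
  have "CARD('n nonempty_subset) = card {\<alpha> :: 'n set. \<alpha> \<noteq> {}}"
    by (rule type_definition.card[OF type_definition_nonempty_subset])
  also have "{\<alpha> :: 'n set. \<alpha> \<noteq> {}} = Pow UNIV - {{}}"
    by auto
  also have "card (Pow UNIV - {{}} :: 'n set set) = 2 ^ CARD('n) - 1"
    by (subst card_Diff_singleton) (auto simp: card_Pow)
  finally show ?thesis .
qed

type_synonym 'n entropy_space = "real ^ 'n nonempty_subset"

definition joint_pmfs :: "('n \<Rightarrow> 'a set) \<Rightarrow> ('n \<Rightarrow> 'a) pmf set" where
  "joint_pmfs X = {p. set_pmf p \<subseteq> (\<Pi>\<^sub>E i\<in>UNIV. X i)}"

definition marginal :: "'n set \<Rightarrow> ('n \<Rightarrow> 'a) pmf \<Rightarrow> ('n \<Rightarrow> 'a) pmf" where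
  "marginal \<alpha> p = map_pmf (\<lambda>x. restrict x \<alpha>) p"

text \<open>The convention \<open>0 log 0 = 0\<close> holds because of the factor \<open>pmf q x\<close>.\<close>

definition shannon_entropy :: "real \<Rightarrow> 'b set \<Rightarrow> 'b pmf \<Rightarrow> real" where
  "shannon_entropy b A q = - (\<Sum>x\<in>A. pmf q x * log b (pmf q x))"

definition entropy_vector ::
    "real \<Rightarrow> ('n \<Rightarrow> 'a set) \<Rightarrow> ('n \<Rightarrow> 'a) pmf \<Rightarrow> 'n::finite entropy_space" where
  "entropy_vector b X p =
    (\<chi> s. shannon_entropy b (\<Pi>\<^sub>E i\<in>the_subset s. X i) (marginal (the_subset s) p))"

definition entropic_region :: "real \<Rightarrow> ('n \<Rightarrow> 'a set) \<Rightarrow> 'n::finite entropy_space set" where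
  "entropic_region b X = entropy_vector b X ` joint_pmfs X"

definition coord :: "'n::finite entropy_space \<Rightarrow> 'n set \<Rightarrow> real" where
  "coord h \<alpha> = (if \<alpha> = {} then 0 else h $ Nonempty \<alpha>)"

definition polymatroids :: "'n::finite entropy_space set" where
  "polymatroids = {h.
     (\<forall>\<alpha>. coord h \<alpha> \<ge> 0) \<and>
     (\<forall>\<alpha> \<beta>. \<alpha> \<subseteq> \<beta> \<longrightarrow> coord h \<alpha> \<le> coord h \<beta>) \<and>
     (\<forall>\<alpha> \<beta>. coord h \<alpha> + coord h \<beta> \<ge> coord h (\<alpha> \<union> \<beta>) + coord h (\<alpha> \<inter> \<beta>))}"

definition open_ray :: "'v::real_vector \<Rightarrow> 'v set" where
  "open_ray y = {a *\<^sub>R y | a. a > 0}"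

text \<open>
  The ray omits the origin and so is not closed. The nearest point selected by
  \<open>closest_point\<close> exists, is unique and is nonzero when \<open>x \<bullet> y > 0\<close>, in particular for
  nonzero polymatroids; \<open>norm_dist x y\<close> is meaningful only in that case.
\<close>

definition norm_dist :: "'v::euclidean_space \<Rightarrow> 'v \<Rightarrow> real" where
  "norm_dist x y =
    (let y' = closest_point (open_ray y) x in norm (x - y') / norm y')"

end

theory Submission imports Defs begin

text \<open>
  An interior point of the entropic region has only positive coordinates, because the region lies
  in the nonnegative orthant; hence its inner product with the target is positive. Moving it
  towards its projection onto the ray of the target does not change the projection, so the
  normalized distance strictly decreases unless the point lies on the ray already.
\<close>

text \<open>The residual \<open>x - c *\<^sub>R y\<close> is orthogonal to \<open>y\<close>, so the
  squared distance from \<open>x\<close> to \<open>a *\<^sub>R y\<close> is a quadratic in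
  \<open>a\<close> with strict minimum at \<open>a = c\<close>. Positivity of
  \<open>x \<bullet> y\<close> makes \<open>c\<close> positive, which puts the minimizer on the ray
  even though the ray is not closed.\<close>

lemma closest_point_open_ray:
  fixes x y :: "'v::euclidean_space"
  assumes "x \<bullet> y > 0"
  shows "closest_point (open_ray y) x = (x \<bullet> y / (y \<bullet> y)) *\<^sub>R y"
proof -
  define c where "c = x \<bullet> y / (y \<bullet> y)"
  have yy: "y \<bullet> y > 0"
    using assms by auto
  have c: "c > 0"
    unfolding c_def using assms yy by simp
  have pythagoras: "(dist x (a *\<^sub>R y))\<^sup>2 = (dist x (c *\<^sub>R y))\<^sup>2 + (a - c)\<^sup>2 * (y \<bullet> y)" for a
  proof -
    have xy: "x \<bullet> y = c * (y \<bullet> y)"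
      unfolding c_def using yy by simp
    have expand: "(dist x (k *\<^sub>R y))\<^sup>2 = x \<bullet> x - 2 * k * (x \<bullet> y) + k\<^sup>2 * (y \<bullet> y)" for k
      unfolding dist_norm power2_norm_eq_inner
      by (simp add: inner_diff_left inner_diff_right inner_commute[of y x] power2_eq_square
          right_diff_distrib)
    show ?thesis
      unfolding expand xy by algebra
  qed
  have minimal: "dist x (c *\<^sub>R y) \<le> dist x (a *\<^sub>R y)" for a
  proof (rule power2_le_imp_le)
    have "(a - c)\<^sup>2 * (y \<bullet> y) \<ge> 0"
      by simp
    then show "(dist x (c *\<^sub>R y))\<^sup>2 \<le> (dist x (a *\<^sub>R y))\<^sup>2"
      using pythagoras[of a] by linarith
  qed simp
  show ?thesis
    unfolding closest_point_def c_def[symmetric]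
  \<comment> \<open>\<open>closest_point\<close> is a Hilbert choice, so its value is fixed only
    once the minimizer is also shown to be unique.\<close>
  proof (rule some_equality)
    show "c *\<^sub>R y \<in> open_ray y \<and> (\<forall>z\<in>open_ray y. dist x (c *\<^sub>R y) \<le> dist x z)"
      using c minimal by (auto simp: open_ray_def)
  next
    fix z assume z: "z \<in> open_ray y \<and> (\<forall>w\<in>open_ray y. dist x z \<le> dist x w)"
    then obtain a where a: "z = a *\<^sub>R y"
      by (auto simp: open_ray_def)
    have "dist x z \<le> dist x (c *\<^sub>R y)"
      using z c by (auto simp: open_ray_def)
    then have "(dist x z)\<^sup>2 \<le> (dist x (c *\<^sub>R y))\<^sup>2"
      by (simp add: power_mono)
    then have "(a - c)\<^sup>2 * (y \<bullet> y) \<le> 0"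
      using pythagoras[of a] unfolding a by linarith
    then have "a = c"
      using yy by (simp add: mult_le_0_iff)
    then show "z = c *\<^sub>R y"
      using a by simp
  qed
qed

text \<open>The displacement is orthogonal to \<open>y\<close>, so \<open>x'\<close> and
  \<open>x\<close> have the same nearest point on the ray, while the distance to that point shrinks
  by the factor \<open>1 - e\<close>.\<close>

lemma norm_dist_decreases_towards_ray:
  fixes x y :: "'v::euclidean_space"
  assumes pos: "x \<bullet> y > 0" and off: "x \<notin> open_ray y" and e: "0 < e" "e \<le> 1"
  defines "x' \<equiv> x + e *\<^sub>R ((x \<bullet> y / (y \<bullet> y)) *\<^sub>R y - x)"
  shows "x' \<bullet> y > 0" and "norm_dist x' y < norm_dist x y"
proof -
  define y' where "y' = (x \<bullet> y / (y \<bullet> y)) *\<^sub>R y"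
  have yy: "y \<bullet> y > 0"
    using pos by auto
  have coef: "x \<bullet> y / (y \<bullet> y) > 0"
    using pos yy by simp
  have same: "x' \<bullet> y = x \<bullet> y"
    unfolding x'_def using yy by (simp add: inner_add_left inner_diff_left)
  show pos': "x' \<bullet> y > 0"
    using pos same by simp
  have "y' \<in> open_ray y"
    using coef by (auto simp: open_ray_def y'_def)
  \<comment> \<open>Strictness of the decrease comes from here: off the ray, \<open>x\<close>
    differs from its projection.\<close>
  then have "norm (x - y') > 0"
    using off by auto
  moreover have "norm y' > 0"
    unfolding y'_def zero_less_norm_iff scaleR_eq_0_iff using yy coef by auto
  moreover have "x' - y' = (1 - e) *\<^sub>R (x - y')"
    unfolding x'_def y'_def[symmetric] by (simp add: algebra_simps)
  then have "norm (x' - y') = (1 - e) * norm (x - y')"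
    using e by simp
  ultimately have "norm (x' - y') / norm y' < norm (x - y') / norm y'"
    using e by (simp add: divide_strict_right_mono)
  then show "norm_dist x' y < norm_dist x y"
    unfolding norm_dist_def closest_point_open_ray[OF pos] closest_point_open_ray[OF pos']
      same y'_def Let_def .
qed

lemma shannon_entropy_nonneg:
  assumes "b > 1"
  shows "shannon_entropy b A q \<ge> 0"
proof -
  have "pmf q x * log b (pmf q x) \<le> 0" for x
  proof (cases "pmf q x = 0")
    case False
    then have "pmf q x > 0"
      using pmf_nonneg[of q x] by linarith
    then have "log b (pmf q x) \<le> 0"
      using assms pmf_le_1[of q x] by simp
    then show ?thesis
      by (simp add: mult_nonneg_nonpos)
  qed simp
  then show ?thesis
    unfolding shannon_entropy_def by (simp add: sum_nonpos)
qed

text \<open>A small step from \<open>h\<close> down the \<open>i\<close>-th axis stays in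
  \<open>S\<close>, where coordinates are still nonnegative. The closed ball allows a step of full
  length \<open>r\<close>, so \<open>h $ i \<ge> r\<close>.\<close>

lemma interior_nonneg_imp_pos:
  fixes S :: "(real ^ 'm::finite) set"
  assumes "h \<in> interior S" and nonneg: "\<And>x i. x \<in> S \<Longrightarrow> x $ i \<ge> 0"
  shows "h $ i > 0"
proof -
  obtain r where r: "r > 0" "cball h r \<subseteq> S"
    using assms(1) mem_interior_cball by blast
  have "h - r *\<^sub>R axis i 1 \<in> cball h r"
    using r by (simp add: dist_norm)
  then have "(h - r *\<^sub>R axis i 1) $ i \<ge> 0"
    using r nonneg by blast
  then show ?thesis
    using r by (simp add: axis_def)
qed

lemma polymatroid_nonneg:
  assumes "h \<in> polymatroids"
  shows "h $ s \<ge> 0"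
proof -
  have "coord h (the_subset s) \<ge> 0"
    using assms by (simp add: polymatroids_def)
  then show ?thesis
    using the_subset[of s] by (simp add: coord_def the_subset_inverse)
qed

text \<open>No term of the inner product is negative, and a nonzero coordinate of \<open>y\<close>
  gives a positive one.\<close>

lemma inner_pos_of_pos_nonneg:
  fixes x y :: "real ^ 'm::finite"
  assumes "\<And>i. x $ i > 0" and "\<And>i. y $ i \<ge> 0" and "y \<noteq> 0"
  shows "x \<bullet> y > 0"
proof -
  obtain i where "y $ i \<noteq> 0"
    using assms(3) by (auto simp: vec_eq_iff)
  then have "x $ i * y $ i > 0"
    using assms(1,2)[of i] by (simp add: less_le)
  moreover have "x $ j * y $ j \<ge> 0" for j
    using assms(1,2)[of j] by simp
  ultimately show ?thesis
    unfolding inner_vec_def by (auto intro!: sum_pos2)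
qed

theorem theorem1:
  fixes b :: real
    and X :: "'n::finite \<Rightarrow> 'a set"
    and p :: "('n \<Rightarrow> 'a) pmf"
    and h h\<^sub>t :: "'n entropy_space"
  assumes "b > 1"
    and "\<And>i. finite (X i)" and "\<And>i. X i \<noteq> {}"
    and "p \<in> joint_pmfs X"
    and "h = entropy_vector b X p" and "h \<noteq> 0"
    and "h\<^sub>t \<in> polymatroids - {0}"
    and "\<not> (\<exists>h' \<in> entropic_region b X - {0}. norm_dist h' h\<^sub>t < norm_dist h h\<^sub>t)"
  shows "h \<in> open_ray h\<^sub>t \<or> h \<in> frontier (entropic_region b X)"
proof (rule ccontr)
  assume contr: "\<not> ?thesis"
  have "h \<in> entropic_region b X"
    using assms(4,5) by (simp add: entropic_region_def)
  then have int: "h \<in> interior (entropic_region b X)"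
    using contr closure_subset by (auto simp: frontier_def)
  have "x $ s \<ge> 0" if "x \<in> entropic_region b X" for x s
    using that shannon_entropy_nonneg[OF \<open>b > 1\<close>]
    by (auto simp: entropic_region_def entropy_vector_def)
  then have pos: "h \<bullet> h\<^sub>t > 0"
    using assms(7) interior_nonneg_imp_pos[OF int] polymatroid_nonneg
    by (intro inner_pos_of_pos_nonneg) auto
  obtain r where r: "r > 0" "cball h r \<subseteq> entropic_region b X"
    using int mem_interior_cball by blast
  define d where "d = (h \<bullet> h\<^sub>t / (h\<^sub>t \<bullet> h\<^sub>t)) *\<^sub>R h\<^sub>t - h"
  \<comment> \<open>The step must be at most 1 so as not to overshoot the projection, and short
    enough that \<open>e * norm d \<le> r\<close>. Adding 1 to \<open>norm d\<close> keeps the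
    denominator positive.\<close>
  define e where "e = min 1 (r / (norm d + 1))"
  have e: "0 < e" "e \<le> 1"
    unfolding e_def using r by (auto simp: add_nonneg_pos)
  have "e * norm d \<le> r / (norm d + 1) * (norm d + 1)"
    unfolding e_def using r by (intro mult_mono) auto
  also have "\<dots> = r"
    using norm_ge_zero[of d] by (simp add: add_nonneg_eq_0_iff)
  finally have "h + e *\<^sub>R d \<in> cball h r"
    using e by (simp add: dist_norm)
  \<comment> \<open>The positive inner product shows that the new point is nonzero, as a competing
    perturbation has to be.\<close>
  moreover have "(h + e *\<^sub>R d) \<bullet> h\<^sub>t > 0" "norm_dist (h + e *\<^sub>R d) h\<^sub>t < norm_dist h h\<^sub>t"
    using norm_dist_decreases_towards_ray[OF pos _ e] contr unfolding d_def by auto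
  ultimately show False
    using assms(8) r by force
qed

end
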